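(* The James space $\mathcal{J}$ has no Besselian Schauder frame and, consequently, has no unconditional Schauder frame.
   Context: The James space $\mathcal{J}$ is the Banach space of all scalar sequences $\xi=(\xi(n))_{n\ge1}$ converging to $0$ with $\|\xi\|_{\mathcal{J}}=\frac{1}{\sqrt2}\sup\big(|\xi(p_n)-\xi(p_0)|^2+\sum_{k=1}^n|\xi(p_k)-\xi(p_{k-1})|^2\big)^{1/2}<\infty$, the supremum being over all $n\ge1$ and all integers $1\le p_0<p_1<\dots<p_n$. A Schauder frame for a Banach space $E$ is a sequence $((a_n,b_n^* ))_{n\ge1}$ in $E\times E^*$ such that for every $x\in E$ the series $\sum_n b_n^*(x)a_n$ converges in norm to $x$; it is an unconditional Schauder frame if all these series converge unconditionally, and a Besselian Schauder frame if there is $B>0$ with $\sum_{n=1}^\infty|b_n^*(x)||y^*(a_n)|\le B\|x\|_E\|y^*\|_{E^*}$ for all $x\in E$, $y^*\in E^*$. *)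

theory Defs
  imports "HOL-Analysis.Analysis"
begin

section \<open>The James space\<close>

text \<open>
  Sequences are indexed by \<^typ>\<open>nat\<close>, that is, from 0 instead of from 1. The scalars
  \<^typ>\<open>'k\<close> range over \<^class>\<open>real_normed_field\<close>, so that the real and the complex
  James space are the types \<open>real james\<close> and \<open>complex james\<close>.
\<close>

definition james_chains :: "(nat \<times> (nat \<Rightarrow> nat)) set" where
  "james_chains = {(n, p). 1 \<le> n \<and> strict_mono_on {..n} p}"

definition james_var :: "nat \<times> (nat \<Rightarrow> nat) \<Rightarrow> (nat \<Rightarrow> 'k::real_normed_field) \<Rightarrow> real" where
  "james_var = (\<lambda>(n, p) \<xi>.
     sqrt ((norm (\<xi> (p n) - \<xi> (p 0)))\<^sup>2 + (\<Sum>k=1..n. (norm (\<xi> (p k) - \<xi> (p (k - 1))))\<^sup>2)))"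

definition james_norm :: "(nat \<Rightarrow> 'k::real_normed_field) \<Rightarrow> real" where
  "james_norm \<xi> = 1 / sqrt 2 * (SUP c\<in>james_chains. james_var c \<xi>)"

definition james_seqs :: "(nat \<Rightarrow> 'k::real_normed_field) set" where
  "james_seqs = {\<xi>. \<xi> \<longlonglongrightarrow> 0 \<and> bdd_above ((\<lambda>c. james_var c \<xi>) ` james_chains)}"

lemma james_var_L2_set:
  "james_var (n, p) \<xi> =
     L2_set (\<lambda>k. norm (\<xi> (p k) - \<xi> (p (if k = 0 then n else k - 1)))) {..n}"
proof -
  have "{..n} = insert 0 {1..n}" by auto
  then show ?thesis
    unfolding james_var_def L2_set_def
    by (auto simp: norm_minus_commute intro!: sum.cong)
qed

lemma james_var_nonneg: "0 \<le> james_var c \<xi>"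
  by (cases c) (simp add: james_var_L2_set)

lemma james_var_zero: "james_var c (\<lambda>_. 0) = 0"
  by (cases c) (simp add: james_var_def)

lemma james_var_add: "james_var c (\<lambda>n. \<xi> n + \<eta> n) \<le> james_var c \<xi> + james_var c \<eta>"
proof (cases c)
  case (Pair n p)
  let ?d = "\<lambda>\<xi> k. norm (\<xi> (p k) - \<xi> (p (if k = 0 then n else k - 1)))"
  have "L2_set (?d (\<lambda>n. \<xi> n + \<eta> n)) {..n} \<le> L2_set (\<lambda>k. ?d \<xi> k + ?d \<eta> k) {..n}"
    by (intro L2_set_mono) (auto simp: add_diff_add intro: norm_triangle_ineq)
  also have "\<dots> \<le> L2_set (?d \<xi>) {..n} + L2_set (?d \<eta>) {..n}"
    by (rule L2_set_triangle_ineq)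
  finally show ?thesis by (simp add: Pair james_var_L2_set)
qed

lemma james_var_scale: "james_var c (\<lambda>n. a * \<xi> n) = norm a * james_var c \<xi>"
  by (cases c)
     (simp add: james_var_L2_set norm_mult L2_set_right_distrib flip: right_diff_distrib)

lemma james_var_tendsto:
  assumes "\<And>m. (\<lambda>i. X i m) \<longlonglongrightarrow> \<xi> m"
  shows "(\<lambda>i. james_var c (X i)) \<longlonglongrightarrow> james_var c \<xi>"
  unfolding james_var_def by (cases c) (auto intro!: tendsto_intros assms)

lemma james_chains_nonempty: "james_chains \<noteq> {}"
proof -
  have "(1, id) \<in> james_chains" by (auto simp: james_chains_def strict_mono_on_def)
  then show ?thesis by blast
qed

lemma james_var_le_norm:
  assumes "\<xi> \<in> james_seqs" "c \<in> james_chains"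
  shows "james_var c \<xi> \<le> sqrt 2 * james_norm \<xi>"
  using assms cSUP_upper[of c james_chains "\<lambda>c. james_var c \<xi>"]
  by (auto simp: james_seqs_def james_norm_def)

lemma james_norm_le:
  assumes "\<And>c. c \<in> james_chains \<Longrightarrow> james_var c \<xi> \<le> sqrt 2 * b"
  shows "james_norm \<xi> \<le> b"
proof -
  have "(SUP c\<in>james_chains. james_var c \<xi>) \<le> sqrt 2 * b"
    by (rule cSUP_least[OF james_chains_nonempty assms])
  then show ?thesis by (simp add: james_norm_def field_simps)
qed

lemma james_seqsI:
  assumes "\<xi> \<longlonglongrightarrow> 0" "\<And>c. c \<in> james_chains \<Longrightarrow> james_var c \<xi> \<le> b"
  shows "\<xi> \<in> james_seqs"
  unfolding james_seqs_def using assms by (intro CollectI conjI bdd_aboveI2)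

lemma james_seqs_tendsto: "\<xi> \<in> james_seqs \<Longrightarrow> \<xi> \<longlonglongrightarrow> 0"
  by (simp add: james_seqs_def)

lemma james_norm_nonneg: "\<xi> \<in> james_seqs \<Longrightarrow> 0 \<le> james_norm \<xi>"
proof -
  assume "\<xi> \<in> james_seqs"
  moreover obtain c where "c \<in> james_chains" using james_chains_nonempty by blast
  ultimately have "0 \<le> sqrt 2 * james_norm \<xi>"
    using james_var_nonneg[of c \<xi>] james_var_le_norm[of \<xi> c] by linarith
  then show ?thesis by (simp add: zero_le_mult_iff)
qed

lemma james_seqs_zero: "(\<lambda>_. 0) \<in> james_seqs"
  by (rule james_seqsI[where b = 0]) (auto simp: james_var_zero)

lemma james_seqs_add:
  assumes "\<xi> \<in> james_seqs" "\<eta> \<in> james_seqs"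
  shows "(\<lambda>n. \<xi> n + \<eta> n) \<in> james_seqs"
proof (rule james_seqsI)
  show "(\<lambda>n. \<xi> n + \<eta> n) \<longlonglongrightarrow> 0"
    using tendsto_add[OF assms[THEN james_seqs_tendsto]] by simp
  show "james_var c (\<lambda>n. \<xi> n + \<eta> n) \<le> sqrt 2 * james_norm \<xi> + sqrt 2 * james_norm \<eta>"
    if "c \<in> james_chains" for c
    using james_var_add[of c \<xi> \<eta>] assms[THEN james_var_le_norm, OF that] by linarith
qed

lemma james_seqs_scale:
  assumes "\<xi> \<in> james_seqs"
  shows "(\<lambda>n. a * \<xi> n) \<in> james_seqs"
proof (rule james_seqsI)
  show "(\<lambda>n. a * \<xi> n) \<longlonglongrightarrow> 0"
    using assms by (auto intro: tendsto_mult_right_zero james_seqs_tendsto)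
  show "james_var c (\<lambda>n. a * \<xi> n) \<le> norm a * (sqrt 2 * james_norm \<xi>)"
    if "c \<in> james_chains" for c
    using james_var_le_norm[OF assms that] by (auto simp: james_var_scale intro: mult_left_mono)
qed

lemma james_seqs_uminus: "\<xi> \<in> james_seqs \<Longrightarrow> (\<lambda>n. - \<xi> n) \<in> james_seqs"
  using james_seqs_scale[of \<xi> "-1"] by simp

lemma james_seqs_diff:
  "\<xi> \<in> james_seqs \<Longrightarrow> \<eta> \<in> james_seqs \<Longrightarrow> (\<lambda>n. \<xi> n - \<eta> n) \<in> james_seqs"
  using james_seqs_add[OF _ james_seqs_uminus, of \<xi> \<eta>] by simp

lemma james_norm_add:
  assumes "\<xi> \<in> james_seqs" "\<eta> \<in> james_seqs"
  shows "james_norm (\<lambda>n. \<xi> n + \<eta> n) \<le> james_norm \<xi> + james_norm \<eta>"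
proof (rule james_norm_le)
  fix c :: "nat \<times> (nat \<Rightarrow> nat)" assume "c \<in> james_chains"
  then show "james_var c (\<lambda>n. \<xi> n + \<eta> n) \<le> sqrt 2 * (james_norm \<xi> + james_norm \<eta>)"
    using james_var_add[of c \<xi> \<eta>] assms[THEN james_var_le_norm, of c]
    by (simp add: distrib_left)
qed

lemma james_norm_scale_le:
  assumes "\<xi> \<in> james_seqs"
  shows "james_norm (\<lambda>n. a * \<xi> n) \<le> norm a * james_norm \<xi>"
proof (rule james_norm_le)
  fix c :: "nat \<times> (nat \<Rightarrow> nat)" assume "c \<in> james_chains"
  then have "norm a * james_var c \<xi> \<le> norm a * (sqrt 2 * james_norm \<xi>)"
    by (intro mult_left_mono james_var_le_norm assms) auto
  then show "james_var c (\<lambda>n. a * \<xi> n) \<le> sqrt 2 * (norm a * james_norm \<xi>)"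
    by (simp add: james_var_scale algebra_simps)
qed

lemma james_norm_zero: "james_norm (\<lambda>_. 0) = 0"
  using james_chains_nonempty by (simp add: james_norm_def james_var_zero)

lemma james_norm_scale:
  assumes "\<xi> \<in> james_seqs"
  shows "james_norm (\<lambda>n. a * \<xi> n) = norm a * james_norm \<xi>"
proof (cases "a = 0")
  case True
  then show ?thesis by (simp add: james_norm_zero)
next
  case False
  have "james_norm \<xi> \<le> norm (inverse a) * james_norm (\<lambda>n. a * \<xi> n)"
    using james_norm_scale_le[OF james_seqs_scale[OF assms, of a], of "inverse a"] False
    by (simp flip: mult.assoc)
  then have "norm a * james_norm \<xi> \<le> james_norm (\<lambda>n. a * \<xi> n)"
    unfolding nonzero_norm_inverse[OF False] using False by (simp add: field_simps)
  with james_norm_scale_le[OF assms, of a] show ?thesis by simp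
qed

lemma james_norm_ge_diff:
  assumes "\<xi> \<in> james_seqs"
  shows "norm (\<xi> m - \<xi> l) \<le> james_norm \<xi>"
proof -
  have *: "norm (\<xi> m - \<xi> l) \<le> james_norm \<xi>" if "l < m" for l m
  proof -
    let ?c = "(1::nat, \<lambda>k::nat. if k = 0 then l else m)"
    have "?c \<in> james_chains" using that
      by (auto simp: james_chains_def strict_mono_on_def)
    from james_var_le_norm[OF assms this] show ?thesis
      by (simp add: james_var_def real_sqrt_mult flip: mult_2)
  qed
  show ?thesis
    using *[of l m] *[of m l] james_norm_nonneg[OF assms]
    by (cases l m rule: linorder_cases) (auto simp: norm_minus_commute)
qed

lemma james_norm_ge:
  assumes "\<xi> \<in> james_seqs"
  shows "norm (\<xi> m) \<le> james_norm \<xi>"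
proof (rule LIMSEQ_le_const2)
  show "(\<lambda>l. norm (\<xi> m - \<xi> l)) \<longlonglongrightarrow> norm (\<xi> m)"
    using tendsto_norm[OF tendsto_diff[OF tendsto_const james_seqs_tendsto[OF assms]]]
    by simp
qed (use james_norm_ge_diff[OF assms] in auto)

typedef (overloaded) 'k james = "james_seqs :: (nat \<Rightarrow> 'k::real_normed_field) set"
  morphisms james_nth Abs_james
  using james_seqs_zero by blast

setup_lifting type_definition_james

lemma james_eqI: "(\<And>n. james_nth x n = james_nth y n) \<Longrightarrow> x = y"
  by transfer auto

lift_definition james_scale :: "'k::real_normed_field \<Rightarrow> 'k james \<Rightarrow> 'k james" is
  "\<lambda>a \<xi> n. a * \<xi> n" by (rule james_seqs_scale)

instantiation james :: (real_normed_field) real_vector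
begin

lift_definition zero_james :: "'a james" is "\<lambda>_. 0" by (rule james_seqs_zero)

lift_definition plus_james :: "'a james \<Rightarrow> 'a james \<Rightarrow> 'a james" is
  "\<lambda>\<xi> \<eta> n. \<xi> n + \<eta> n" by (rule james_seqs_add)

lift_definition minus_james :: "'a james \<Rightarrow> 'a james \<Rightarrow> 'a james" is
  "\<lambda>\<xi> \<eta> n. \<xi> n - \<eta> n" by (rule james_seqs_diff)

lift_definition uminus_james :: "'a james \<Rightarrow> 'a james" is
  "\<lambda>\<xi> n. - \<xi> n" by (rule james_seqs_uminus)

lift_definition scaleR_james :: "real \<Rightarrow> 'a james \<Rightarrow> 'a james" is
  "\<lambda>r \<xi> n. r *\<^sub>R \<xi> n"
  unfolding scaleR_conv_of_real by (rule james_seqs_scale)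

instance
  by standard (transfer; force simp: algebra_simps)+

end

instantiation james :: (real_normed_field) real_normed_vector
begin

lift_definition norm_james :: "'a james \<Rightarrow> real" is james_norm .

definition dist_james :: "'a james \<Rightarrow> 'a james \<Rightarrow> real" where
  "dist_james x y = norm (x - y)"

definition uniformity_james :: "('a james \<times> 'a james) filter" where
  "uniformity_james = (INF e\<in>{0<..}. principal {(x, y). dist x y < e})"

definition open_james :: "'a james set \<Rightarrow> bool" where
  "open_james U \<longleftrightarrow> (\<forall>x\<in>U. \<forall>\<^sub>F (x', y) in uniformity. x' = x \<longrightarrow> y \<in> U)"

definition sgn_james :: "'a james \<Rightarrow> 'a james" where
  "sgn_james x = x /\<^sub>R norm x"

instance
proof
  fix x y :: "'a james" and r :: real
  show "norm (x + y) \<le> norm x + norm y"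
    by transfer (rule james_norm_add)
  show "norm (r *\<^sub>R x) = \<bar>r\<bar> * norm x"
    by transfer (simp add: scaleR_conv_of_real james_norm_scale)
  show "norm x = 0 \<longleftrightarrow> x = 0"
  proof transfer
    fix \<xi> :: "nat \<Rightarrow> 'a" assume \<xi>: "\<xi> \<in> james_seqs"
    show "james_norm \<xi> = 0 \<longleftrightarrow> \<xi> = (\<lambda>_. 0)"
      using james_norm_ge[OF \<xi>] by (auto simp: james_norm_zero)
  qed
qed (simp_all add: dist_james_def uniformity_james_def open_james_def sgn_james_def)

end

instance james :: ("{real_normed_field, banach}") banach
proof
  fix X :: "nat \<Rightarrow> 'a james"
  assume X: "Cauchy X"
  define Y where "Y = (\<lambda>i. james_nth (X i))"
  have Y: "Y i \<in> james_seqs" for i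
    by (simp add: Y_def james_nth)
  have norm_diff: "norm (X i - X j) = james_norm (\<lambda>m. Y i m - Y j m)" for i j
    unfolding Y_def by transfer simp
  have close: "\<exists>N. \<forall>i\<ge>N. \<forall>j\<ge>N. james_norm (\<lambda>m. Y i m - Y j m) < e" if "e > 0" for e
    using CauchyD[OF X that] by (simp add: norm_diff)
  have "uniformly_convergent_on UNIV Y"
  proof (rule Cauchy_uniformly_convergent)
    show "uniformly_Cauchy_on UNIV Y"
      unfolding uniformly_Cauchy_on_def dist_norm
    proof (intro allI impI)
      fix e :: real assume "e > 0"
      then obtain N where "\<And>i j. i \<ge> N \<Longrightarrow> j \<ge> N \<Longrightarrow> james_norm (\<lambda>m. Y i m - Y j m) < e"
        using close by blast
      then have "norm (Y i m - Y j m) < e" if "i \<ge> N" "j \<ge> N" for i j m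
        using james_norm_ge[OF james_seqs_diff[OF Y[of i] Y[of j]], of m] that
        by (meson order_le_less_trans)
      then show "\<exists>M. \<forall>m\<in>UNIV. \<forall>i\<ge>M. \<forall>j\<ge>M. norm (Y i m - Y j m) < e"
        by blast
    qed
  qed
  then obtain \<xi> where \<xi>: "uniform_limit UNIV Y \<xi> sequentially"
    by (auto simp: uniformly_convergent_on_def)
  then have lim: "(\<lambda>i. Y i m) \<longlonglongrightarrow> \<xi> m" for m
    by (rule tendsto_uniform_limitI) simp
  have "\<xi> \<longlonglongrightarrow> 0"
    by (rule swap_uniform_limit'[where g = "\<lambda>_. 0", OF _ _ \<xi>])
       (auto intro!: always_eventually james_seqs_tendsto[OF Y])
  have var: "\<exists>N. \<forall>i\<ge>N. \<forall>c\<in>james_chains. james_var c (\<lambda>m. Y i m - \<xi> m) \<le> sqrt 2 * e"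
    if "e > 0" for e :: real
  proof -
    obtain N where N: "\<And>i j. i \<ge> N \<Longrightarrow> j \<ge> N \<Longrightarrow> james_norm (\<lambda>m. Y i m - Y j m) < e"
      using close[OF \<open>e > 0\<close>] by blast
    have "james_var c (\<lambda>m. Y i m - \<xi> m) \<le> sqrt 2 * e" if "i \<ge> N" "c \<in> james_chains" for i c
    proof (rule LIMSEQ_le_const2)
      show "(\<lambda>j. james_var c (\<lambda>m. Y i m - Y j m)) \<longlonglongrightarrow> james_var c (\<lambda>m. Y i m - \<xi> m)"
        by (intro james_var_tendsto tendsto_intros lim)
      have "james_var c (\<lambda>m. Y i m - Y j m) \<le> sqrt 2 * e" if "j \<ge> N" for j
      proof -
        have "james_var c (\<lambda>m. Y i m - Y j m) \<le> sqrt 2 * james_norm (\<lambda>m. Y i m - Y j m)"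
          by (intro james_var_le_norm james_seqs_diff Y \<open>c \<in> james_chains\<close>)
        also have "\<dots> \<le> sqrt 2 * e"
          using N[OF \<open>i \<ge> N\<close> that] by simp
        finally show ?thesis .
      qed
      then show "\<exists>M. \<forall>j\<ge>M. james_var c (\<lambda>m. Y i m - Y j m) \<le> sqrt 2 * e" by blast
    qed
    then show ?thesis by blast
  qed
  have diff: "\<exists>N. \<forall>i\<ge>N. (\<lambda>m. Y i m - \<xi> m) \<in> james_seqs \<and> james_norm (\<lambda>m. Y i m - \<xi> m) \<le> e"
    if "e > 0" for e :: real
  proof -
    obtain N where N: "\<And>i c. i \<ge> N \<Longrightarrow> c \<in> james_chains \<Longrightarrow>
        james_var c (\<lambda>m. Y i m - \<xi> m) \<le> sqrt 2 * e"
      using var[OF \<open>e > 0\<close>] by blast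
    have "(\<lambda>m. Y i m - \<xi> m) \<longlonglongrightarrow> 0" for i
      using tendsto_diff[OF james_seqs_tendsto[OF Y] \<open>\<xi> \<longlonglongrightarrow> 0\<close>, of i] by simp
    then have "(\<lambda>m. Y i m - \<xi> m) \<in> james_seqs \<and> james_norm (\<lambda>m. Y i m - \<xi> m) \<le> e"
      if "i \<ge> N" for i
      using james_seqsI[OF _ N[OF that]] james_norm_le[OF N[OF that]] by blast
    then show ?thesis by blast
  qed
  obtain N where "(\<lambda>m. Y N m - \<xi> m) \<in> james_seqs"
    using diff[of 1] by auto
  from james_seqs_diff[OF Y[of N] this] have "\<xi> \<in> james_seqs" by simp
  then have eq: "norm (X i - Abs_james \<xi>) = james_norm (\<lambda>m. Y i m - \<xi> m)" for i
    by (simp add: norm_james.rep_eq minus_james.rep_eq Abs_james_inverse Y_def)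
  have "X \<longlonglongrightarrow> Abs_james \<xi>"
    unfolding LIMSEQ_iff
  proof (intro allI impI)
    fix e :: real assume "e > 0"
    with diff[of "e / 2"] obtain N where
      "\<And>i. i \<ge> N \<Longrightarrow> james_norm (\<lambda>m. Y i m - \<xi> m) \<le> e / 2"
      by auto
    with \<open>e > 0\<close> show "\<exists>N. \<forall>i\<ge>N. norm (X i - Abs_james \<xi>) < e"
      by (intro exI[of _ N]) (force simp: eq)
  qed
  then show "convergent X" by (rule convergentI)
qed

lemma vector_space_james_scale: "vector_space james_scale"
  by unfold_locales (transfer; force simp: algebra_simps)+

lemma norm_james_scale: "norm (james_scale a x) = norm a * norm x"
  by transfer (rule james_norm_scale)

lemma james_scale_of_real: "james_scale (of_real r) x = r *\<^sub>R x"
  by transfer (simp add: scaleR_conv_of_real)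


section \<open>Schauder frames\<close>

text \<open>
  The functions below take as their first argument \<open>s\<close> the multiplication of vectors by
  scalars from \<^typ>\<open>'k\<close>, because \<^class>\<open>banach\<close> only provides a real one. For
  \<^typ>\<open>'k\<close>-linear functionals, \<^const>\<open>onorm\<close> is the norm of the dual space also
  if \<^typ>\<open>'k\<close> is \<^typ>\<open>complex\<close>.
\<close>

definition dual_space :: "('k::real_normed_field \<Rightarrow> 'a::banach \<Rightarrow> 'a) \<Rightarrow> ('a \<Rightarrow> 'k) set" where
  "dual_space s = {f. bounded_linear f \<and> (\<forall>c x. f (s c x) = c * f x)}"

definition unconditionally_summable :: "(nat \<Rightarrow> 'a::real_normed_vector) \<Rightarrow> bool" where
  "unconditionally_summable f \<longleftrightarrow> (\<forall>\<pi>. bij \<pi> \<longrightarrow> summable (\<lambda>n. f (\<pi> n)))"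

definition schauder_frame ::
  "('k::real_normed_field \<Rightarrow> 'a::banach \<Rightarrow> 'a) \<Rightarrow> (nat \<Rightarrow> 'a) \<Rightarrow> (nat \<Rightarrow> 'a \<Rightarrow> 'k) \<Rightarrow> bool" where
  "schauder_frame s a b \<longleftrightarrow>
     (\<forall>n. b n \<in> dual_space s) \<and> (\<forall>x. (\<lambda>n. s (b n x) (a n)) sums x)"

definition unconditional_schauder_frame ::
  "('k::real_normed_field \<Rightarrow> 'a::banach \<Rightarrow> 'a) \<Rightarrow> (nat \<Rightarrow> 'a) \<Rightarrow> (nat \<Rightarrow> 'a \<Rightarrow> 'k) \<Rightarrow> bool" where
  "unconditional_schauder_frame s a b \<longleftrightarrow>
     schauder_frame s a b \<and> (\<forall>x. unconditionally_summable (\<lambda>n. s (b n x) (a n)))"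

definition besselian_schauder_frame ::
  "('k::real_normed_field \<Rightarrow> 'a::banach \<Rightarrow> 'a) \<Rightarrow> (nat \<Rightarrow> 'a) \<Rightarrow> (nat \<Rightarrow> 'a \<Rightarrow> 'k) \<Rightarrow> bool" where
  "besselian_schauder_frame s a b \<longleftrightarrow>
     schauder_frame s a b \<and>
     (\<exists>B>0. \<forall>x. \<forall>y\<in>dual_space s.
        summable (\<lambda>n. norm (b n x) * norm (y (a n))) \<and>
        (\<Sum>n. norm (b n x) * norm (y (a n))) \<le> B * norm x * onorm y)"

end

theory Submission
  imports Defs "HOL-Complex_Analysis.Great_Picard"
begin

text \<open>
  Let \<open>s\<^sub>k\<close> be the indicator of \<open>{..k}\<close> (\<open>james_step k\<close>). For increasing \<open>k\<close> and \<open>m\<close>, both the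
  vector \<open>\<Sum>l<2J. (-1)^l s\<^bsub>k l\<^esub>\<close> and the functional \<open>x \<mapsto> \<Sum>l<2J. (-1)^l x(m l)\<close> have norm at most
  \<open>sqrt (2 J)\<close>. On the other hand, a gliding hump makes the \<open>\<ell>\<^sup>1\<close> norm of an alternating sum of
  \<open>2 J\<close> members of a coordinatewise null sequence in \<open>\<ell>\<^sup>1\<close> grow like \<open>J\<close>, unless their sums tend
  to 0.

  Let \<open>(a\<^sub>n, b\<^sub>n)\<close> be a Besselian frame and pass to a subsequence along which \<open>b\<^sub>n(s\<^sub>k)\<close> tends to some
  \<open>c\<^sub>n\<close> for every \<open>n\<close>. Since \<open>\<Sum>n. b\<^sub>n(s\<^sub>k) a\<^sub>n(m) = 1\<close> for \<open>k \<ge> m\<close>, the gliding hump applied to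
  \<open>(b\<^sub>n(s\<^sub>k) - c\<^sub>n) a\<^sub>n(m)\<close> as \<open>k\<close> varies gives \<open>\<Sum>n. c\<^sub>n a\<^sub>n(m) = 1\<close> for every \<open>m\<close>. Applied to
  \<open>c\<^sub>n a\<^sub>n(m)\<close> as \<open>m\<close> varies, it gives \<open>1 = 0\<close>.

  An unconditional frame is Besselian by the uniform boundedness principle for the operators
  \<open>x \<mapsto> \<Sum>n\<in>F. b\<^sub>n(x) a\<^sub>n\<close> with \<open>F\<close> finite.
\<close>

section \<open>Gliding humps for absolutely summable rows\<close>

lemma sum_consecutive_intervals:
  fixes f :: "nat \<Rightarrow> 'a::comm_monoid_add"
  assumes "\<And>j. a j \<le> a (Suc j)"
  shows "(\<Sum>j<L. \<Sum>n\<in>{a j..<a (Suc j)}. f n) = (\<Sum>n\<in>{a 0..<a L}. f n)"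
  by (induction L) (simp_all add: sum.atLeastLessThan_concat lift_Suc_mono_le assms)

text \<open>Coordinatewise decay allows rows to be picked one after another so that almost all mass
  of each lies on a block of its own, the blocks being consecutive. Terms on different blocks cannot
  cancel, whatever the signs, so \<open>2 * J\<close> rows contribute at least
  \<open>J * norm \<sigma>\<close>. This outgrows \<open>C * sqrt (real J)\<close> unless
  \<open>\<sigma> = 0\<close>; it matters that \<open>C\<close> depends on neither \<open>k\<close>,
  \<open>J\<close> nor \<open>N\<close>.\<close>

lemma gliding_hump:
  fixes g :: "nat \<Rightarrow> nat \<Rightarrow> 'a::banach"
  assumes summ: "\<And>i. summable (\<lambda>n. norm (g i n))"
    and null: "\<And>n. (\<lambda>i. g i n) \<longlonglongrightarrow> 0"
    and sum: "\<And>i. (\<Sum>n. g i n) = \<sigma>"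
    and bound: "\<And>k J N. strict_mono k \<Longrightarrow>
      (\<Sum>n<N. norm (\<Sum>l<2*J. (-1) ^ l *\<^sub>R g (k l) n)) \<le> C * sqrt (real J)"
  shows "\<sigma> = 0"
proof (rule ccontr)
  assume "\<sigma> \<noteq> 0"
  define d where "d = norm \<sigma>"
  \<comment> \<open>A row can fall short of \<open>d\<close> by \<open>2 * e\<close> on its own
    block and can disturb the other blocks by \<open>2 * e\<close>, so
    \<open>d - 4 * e = d / 2\<close> survives per row.\<close>
  define e where "e = d / 8"
  have "d > 0" "e > 0" using \<open>\<sigma> \<noteq> 0\<close> by (simp_all add: d_def e_def)
  txt \<open>Up to mass \<open>2 * e\<close>, \<open>g k\<close> is supported on \<open>{a..<b}\<close>.\<close>
  define hump where "hump = (\<lambda>(k, a, b).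
    a \<le> b \<and> (\<Sum>n<a. norm (g k n)) \<le> e \<and> (\<forall>M. (\<Sum>n\<in>{b..<M}. norm (g k n)) \<le> e) \<and>
    d - 2 * e \<le> norm (\<Sum>n\<in>{a..<b}. g k n))"
  \<comment> \<open>The order of choice is essential: first \<open>k\<close>, late enough that the
    row is small before \<open>a\<close>, and then \<open>b\<close>, far enough out that the tail of
    this row is small and its partial sum is close to \<open>\<sigma>\<close>.\<close>
  have step: "\<exists>k>k0. \<exists>b. hump (k, a, b)" for k0 a
  proof -
    have "(\<lambda>k. \<Sum>n<a. norm (g k n)) \<longlonglongrightarrow> (\<Sum>n<a. 0)"
      by (intro tendsto_sum tendsto_norm_zero null)
    then have "eventually (\<lambda>k. (\<Sum>n<a. norm (g k n)) < e) sequentially"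
      using \<open>e > 0\<close> by (simp add: order_tendstoD(2))
    then obtain k where k: "k > k0" "(\<Sum>n<a. norm (g k n)) < e"
      using eventually_gt_at_top[of k0] by (metis (mono_tags, lifting) eventually_conj eventually_happens' sequentially_bot)
    obtain b1 where b1: "\<And>m n. b1 \<le> m \<Longrightarrow> norm (\<Sum>n\<in>{m..<n}. norm (g k n)) < e"
      using summ[of k] \<open>e > 0\<close> unfolding summable_Cauchy by blast
    have "(\<lambda>b. norm (\<Sum>n<b. g k n)) \<longlonglongrightarrow> d"
      unfolding d_def using summable_norm_cancel[OF summ[of k]] sum[of k]
      by (intro tendsto_norm) (metis summable_LIMSEQ)
    then have "eventually (\<lambda>b. d - e < norm (\<Sum>n<b. g k n)) sequentially"
      using \<open>e > 0\<close> by (simp add: order_tendstoD(1))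
    then obtain b2 where b2: "\<And>b. b \<ge> b2 \<Longrightarrow> d - e < norm (\<Sum>n<b. g k n)"
      by (auto simp: eventually_sequentially)
    obtain b where b: "a \<le> b" "b1 \<le> b" "b2 \<le> b"
      using that[of "max a (max b1 b2)"] by simp
    have "(\<Sum>n<b. g k n) = (\<Sum>n<a. g k n) + (\<Sum>n\<in>{a..<b}. g k n)"
      using b(1) by (simp add: lessThan_atLeast0 sum.atLeastLessThan_concat)
    then have "norm (\<Sum>n<b. g k n) \<le> (\<Sum>n<a. norm (g k n)) + norm (\<Sum>n\<in>{a..<b}. g k n)"
      by (metis add_right_mono norm_sum norm_triangle_le)
    then have "d - 2 * e \<le> norm (\<Sum>n\<in>{a..<b}. g k n)"
      using b2[OF b(3)] k(2) by linarith
    moreover have "(\<Sum>n\<in>{b..<M}. norm (g k n)) \<le> e" for M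
      using b1[OF b(2), of M] by simp
    ultimately have "hump (k, a, b)"
      using k b(1) by (auto simp: hump_def)
    with k(1) show ?thesis by blast
  qed
  have "\<exists>f. \<forall>j. hump (f j) \<and>
    (fst (f j) < fst (f (Suc j)) \<and> fst (snd (f (Suc j))) = snd (snd (f j)))"
    by (rule dependent_nat_choice) (use step in fastforce)+
  then obtain f where f: "\<And>j. hump (f j)" "\<And>j. fst (f j) < fst (f (Suc j))"
    "\<And>j. fst (snd (f (Suc j))) = snd (snd (f j))"
    by blast
  define k where "k = (\<lambda>j. fst (f j))"
  define a where "a = (\<lambda>j. fst (snd (f j)))"
  have hump: "hump (k j, a j, a (Suc j))" for j
    using f(1)[of j] f(3)[of j] by (simp add: k_def a_def)
  have k: "strict_mono k"
    using f(2) by (simp add: strict_mono_Suc_iff k_def)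
  have a: "a i \<le> a j" if "i \<le> j" for i j
    using hump by (intro lift_Suc_mono_le[OF _ that]) (auto simp: hump_def)
  \<comment> \<open>\<open>G l j\<close> is the mass of row \<open>k l\<close> on block
    \<open>j\<close>; only the diagonal is large.\<close>
  define G where "G = (\<lambda>l j. \<Sum>n\<in>{a j..<a (Suc j)}. norm (g (k l) n))"
  have lower: "real L * (d / 2) \<le> (\<Sum>n<a L. norm (\<Sum>l<L. (-1) ^ l *\<^sub>R g (k l) n))" for L
  proof -
    define h where "h = (\<lambda>n. \<Sum>l<L. (-1) ^ l *\<^sub>R g (k l) n)"
    have block: "d - 2 * e - ((\<Sum>l<L. G l j) - G j j) \<le> (\<Sum>n\<in>{a j..<a (Suc j)}. norm (h n))"
      if "j < L" for j
    proof -
      define v where "v = (\<lambda>l. (-1) ^ l *\<^sub>R (\<Sum>n\<in>{a j..<a (Suc j)}. g (k l) n))"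
      have v: "norm (v l) \<le> G l j" for l
        unfolding v_def G_def by (simp add: norm_sum)
      have "(\<Sum>n\<in>{a j..<a (Suc j)}. h n) = (\<Sum>l<L. v l)"
        unfolding h_def v_def by (subst sum.swap) (simp add: scaleR_sum_right)
      also have "\<dots> = v j + (\<Sum>l\<in>{..<L} - {j}. v l)"
        using that by (simp add: sum.remove)
      finally have "norm (v j) \<le> norm (\<Sum>n\<in>{a j..<a (Suc j)}. h n) + norm (\<Sum>l\<in>{..<L} - {j}. v l)"
        by (metis add_diff_cancel_right' norm_triangle_ineq4)
      also have "norm (\<Sum>l\<in>{..<L} - {j}. v l) \<le> (\<Sum>l\<in>{..<L} - {j}. G l j)"
        by (rule sum_norm_le) (rule v)
      also have "\<dots> = (\<Sum>l<L. G l j) - G j j"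
        using that by (simp add: sum_diff1)
      also have "norm (\<Sum>n\<in>{a j..<a (Suc j)}. h n) \<le> (\<Sum>n\<in>{a j..<a (Suc j)}. norm (h n))"
        by (rule norm_sum)
      finally show ?thesis
        using hump[of j] by (simp add: v_def hump_def)
    qed
    have off: "(\<Sum>j<L. G l j) - G l l \<le> 2 * e" if "l < L" for l
    proof -
      let ?f = "\<lambda>n. norm (g (k l) n)"
      have "(\<Sum>j<L. G l j) = (\<Sum>n\<in>{a 0..<a L}. ?f n)"
        unfolding G_def by (rule sum_consecutive_intervals) (simp add: a)
      also have "\<dots> = (\<Sum>n\<in>{a 0..<a l}. ?f n) + (\<Sum>n\<in>{a l..<a L}. ?f n)"
        using that by (simp add: a sum.atLeastLessThan_concat)
      also have "(\<Sum>n\<in>{a l..<a L}. ?f n) = G l l + (\<Sum>n\<in>{a (Suc l)..<a L}. ?f n)"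
        using that by (simp add: G_def a sum.atLeastLessThan_concat)
      also have "(\<Sum>n\<in>{a 0..<a l}. ?f n) \<le> (\<Sum>n<a l. ?f n)"
        by (rule sum_mono2) auto
      finally show ?thesis
        using hump[of l] by (auto simp: hump_def dest: spec[of _ "a L"])
    qed
    have "real L * (d / 2) = (\<Sum>j<L. d - 2 * e) - (\<Sum>l<L. 2 * e)"
      by (simp add: e_def field_simps)
    also have "\<dots> \<le> (\<Sum>j<L. d - 2 * e) - (\<Sum>l<L. (\<Sum>j<L. G l j) - G l l)"
      by (intro diff_left_mono sum_mono off) auto
    \<comment> \<open>\<open>off\<close> controls the off-diagonal masses of one row over all
      blocks, while \<open>block\<close> loses those of all rows on one block; summed over
      everything the two agree.\<close>
    also have "(\<Sum>l<L. (\<Sum>j<L. G l j) - G l l) = (\<Sum>j<L. (\<Sum>l<L. G l j) - G j j)"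
      by (simp add: sum_subtractf) (rule sum.swap)
    also have "(\<Sum>j<L. d - 2 * e) - (\<Sum>j<L. (\<Sum>l<L. G l j) - G j j) \<le>
        (\<Sum>j<L. \<Sum>n\<in>{a j..<a (Suc j)}. norm (h n))"
      unfolding sum_subtractf[symmetric] by (rule sum_mono) (use block in auto)
    also have "\<dots> = (\<Sum>n\<in>{a 0..<a L}. norm (h n))"
      by (rule sum_consecutive_intervals) (simp add: a)
    also have "\<dots> \<le> (\<Sum>n<a L. norm (h n))"
      by (rule sum_mono2) auto
    finally show ?thesis by (simp add: h_def)
  qed
  have le: "sqrt (real J) * d \<le> C" if "J > 0" for J
  proof -
    have "real J * d \<le> C * sqrt (real J)"
      using lower[of "2 * J"] bound[OF k, where J = J and N = "a (2 * J)"] by simp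
    also have "real J = sqrt (real J) * sqrt (real J)" by simp
    finally show ?thesis using that by (simp add: mult.commute mult.left_commute del: real_sqrt_mult_self)
  qed
  obtain J :: nat where J: "(\<bar>C\<bar> / d + 1)\<^sup>2 < real J"
    using reals_Archimedean2 by blast
  have "\<bar>C\<bar> / d + 1 < sqrt (real J)"
    using J \<open>d > 0\<close> by (intro real_less_rsqrt) auto
  then have "\<bar>C\<bar> + d < sqrt (real J) * d"
    using \<open>d > 0\<close> by (simp add: field_simps)
  moreover have "J > 0"
    using J by (cases J) auto
  ultimately show False using le[of J] \<open>d > 0\<close> by linarith
qed

section \<open>Uniform boundedness by Baire category\<close>

lemma uniform_boundedness:
  fixes T :: "'i \<Rightarrow> 'a::banach \<Rightarrow> 'b::real_normed_vector"
  assumes lin: "\<And>i. i \<in> I \<Longrightarrow> bounded_linear (T i)"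
    and ptw: "\<And>x. \<exists>M. \<forall>i\<in>I. norm (T i x) \<le> M"
  obtains C where "C > 0" "\<And>i x. i \<in> I \<Longrightarrow> norm (T i x) \<le> C * norm x"
proof -
  define A where "A = (\<lambda>n::nat. \<Inter>i\<in>I. {x. norm (T i x) \<le> real n})"
  have closed: "closed (A n)" for n
    unfolding A_def
    by (intro closed_INT ballI closed_Collect_le continuous_intros)
       (simp add: lin linear_continuous_on)
  have "(\<Union>n. A n) = UNIV"
  proof (intro equalityI subsetI UNIV_I)
    fix x :: 'a
    obtain M where "\<forall>i\<in>I. norm (T i x) \<le> M" using ptw by blast
    moreover obtain n :: nat where "M \<le> real n" using real_arch_simple by blast
    ultimately have "x \<in> A n" unfolding A_def by (auto intro: order_trans)
    then show "x \<in> (\<Union>n. A n)" by blast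
  qed
  then have "\<exists>n. interior (A n) \<noteq> {}"
    using Baire_category_alt[of "euclidean :: 'a topology" "range A"] closed
    by (force simp: completely_metrizable_space_euclidean)
  then obtain n x r where r: "r > 0" "cball x r \<subseteq> A n"
    by (metis ex_in_conv mem_interior_cball)
  \<comment> \<open>The summand 1 keeps the constant positive even if \<open>n = 0\<close>.\<close>
  have "norm (T i z) \<le> (2 * real n / r + 1) * norm z" if "i \<in> I" for i z
  proof (cases "z = 0")
    case True
    then show ?thesis using lin[OF that] by (simp add: linear_simps(3))
  next
    case False
    interpret bounded_linear "T i" using lin[OF that] .
    \<comment> \<open>\<open>w\<close> lies on the boundary of the ball in the direction of
      \<open>z\<close>, so \<open>T i z\<close> is a multiple of a difference of two values bounded
      by \<open>n\<close>.\<close>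
    define w where "w = x + (r / norm z) *\<^sub>R z"
    have "w \<in> cball x r" "x \<in> cball x r"
      using r False by (auto simp: w_def dist_norm)
    with r(2) have "w \<in> A n" "x \<in> A n" by blast+
    with that have *: "norm (T i w) \<le> real n" "norm (T i x) \<le> real n"
      by (auto simp: A_def)
    have "(r / norm z) * norm (T i z) = norm (T i w - T i x)"
      using r by (simp add: w_def add scaleR)
    also have "\<dots> \<le> 2 * real n"
      using * norm_triangle_ineq4[of "T i w" "T i x"] by linarith
    finally have "norm (T i z) \<le> (2 * real n / r) * norm z"
      using r False by (simp add: field_simps)
    also have "\<dots> \<le> (2 * real n / r + 1) * norm z"
      by (intro mult_right_mono) auto
    finally show ?thesis .
  qed
  moreover have "2 * real n / r + 1 > 0"
    using r by (simp add: add_nonneg_pos)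
  ultimately show ?thesis using that by blast
qed

section \<open>Variation and alternating sums in the James space\<close>

text \<open>Increments of size at most 1 dominate their squares, so the consecutive squares along a
  chain add up to at most the total variation. The closing term is again at most \<open>V\<close>,
  and the resulting \<open>2 * V\<close> is matched by the factor \<open>1 / sqrt 2\<close> in the
  norm.\<close>

lemma james_var_le_variation:
  fixes \<xi> :: "nat \<Rightarrow> 'k::real_normed_field"
  assumes osc: "\<And>i j. norm (\<xi> i - \<xi> j) \<le> 1"
    and var: "\<And>N. (\<Sum>i<N. norm (\<xi> (Suc i) - \<xi> i)) \<le> V"
    and c: "c \<in> james_chains"
  shows "james_var c \<xi> \<le> sqrt 2 * sqrt V"
proof -
  obtain n p where np: "c = (n, p)" "1 \<le> n" "strict_mono_on {..n} p"
    using c by (auto simp: james_chains_def)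
  have mono: "p i \<le> p j" if "i \<le> j" "j \<le> n" for i j
    using that np(3) by (auto simp: strict_mono_on_def le_less)
  have jump: "norm (\<xi> j - \<xi> i) \<le> (\<Sum>l\<in>{i..<j}. norm (\<xi> (Suc l) - \<xi> l))" if "i \<le> j" for i j
    using norm_sum[of "\<lambda>l. \<xi> (Suc l) - \<xi> l" "{i..<j}"] that by (simp add: sum_Suc_diff')
  have sq: "(norm (\<xi> i - \<xi> j))\<^sup>2 \<le> norm (\<xi> i - \<xi> j)" for i j
    using osc[of i j] by (simp add: power2_eq_square mult_left_le)
  have le_V: "(\<Sum>l\<in>{p 0..<p n}. norm (\<xi> (Suc l) - \<xi> l)) \<le> V"
    by (rule order_trans[OF _ var[of "p n"]], rule sum_mono2) auto
  have "(\<Sum>k=1..n. (norm (\<xi> (p k) - \<xi> (p (k - 1))))\<^sup>2) = (\<Sum>k<n. (norm (\<xi> (p (Suc k)) - \<xi> (p k)))\<^sup>2)"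
    by (rule sum.reindex_bij_witness[of _ Suc "\<lambda>k. k - 1"]) auto
  also have "\<dots> \<le> (\<Sum>k<n. \<Sum>l\<in>{p k..<p (Suc k)}. norm (\<xi> (Suc l) - \<xi> l))"
    by (intro sum_mono order_trans[OF sq jump] mono) auto
  also have "\<dots> = (\<Sum>l\<in>{p 0..<p n}. norm (\<xi> (Suc l) - \<xi> l))"
  proof -
    \<comment> \<open>\<open>p\<close> is monotone only on \<open>{..n}\<close>; freezing it after
      \<open>n\<close> gives a sequence that is monotone everywhere.\<close>
    define q where "q = (\<lambda>k. p (min k n))"
    have "(\<Sum>k<n. \<Sum>l\<in>{q k..<q (Suc k)}. norm (\<xi> (Suc l) - \<xi> l)) =
        (\<Sum>l\<in>{q 0..<q n}. norm (\<xi> (Suc l) - \<xi> l))"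
      by (rule sum_consecutive_intervals) (auto simp: q_def intro!: mono)
    then show ?thesis by (simp add: q_def)
  qed
  finally have "(norm (\<xi> (p n) - \<xi> (p 0)))\<^sup>2 + (\<Sum>k=1..n. (norm (\<xi> (p k) - \<xi> (p (k - 1))))\<^sup>2) \<le> 2 * V"
    using order_trans[OF sq jump[OF mono]] le_V by (smt (verit) le0 order_refl)
  then show ?thesis
    unfolding np(1) james_var_def by (simp flip: real_sqrt_mult)
qed

lift_definition james_step :: "nat \<Rightarrow> 'k::real_normed_field james" is
  "\<lambda>k m. if m \<le> k then 1 else 0"
proof -
  fix k :: nat
  let ?\<xi> = "\<lambda>m. if m \<le> k then 1 else 0 :: 'k"
  have "(\<Sum>i<N. norm (?\<xi> (Suc i) - ?\<xi> i)) \<le> 1" for N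
  proof -
    have "(\<Sum>i<N. norm (?\<xi> (Suc i) - ?\<xi> i)) = (\<Sum>i<N. if i = k then 1 else 0)"
      by (rule sum.cong) auto
    then show ?thesis by simp
  qed
  then have "james_var c ?\<xi> \<le> sqrt 2 * sqrt 1" if "c \<in> james_chains" for c
    using that by (intro james_var_le_variation) auto
  moreover have "?\<xi> \<longlonglongrightarrow> 0"
    by (rule tendsto_eventually) (auto simp: eventually_sequentially intro!: exI[of _ "Suc k"])
  ultimately show "?\<xi> \<in> james_seqs"
    by (intro james_seqsI)
qed

lemma bounded_linear_james_nth: "bounded_linear (\<lambda>x. james_nth x m)"
  by (rule bounded_linear_intro[where K = 1])
     (simp_all add: plus_james.rep_eq scaleR_james.rep_eq norm_james.rep_eq james_norm_ge james_nth)

lemma james_nth_tendsto: "james_nth x \<longlonglongrightarrow> 0"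
  using james_nth james_seqs_tendsto by blast

lemma james_norm_le_variation:
  fixes x :: "'k::real_normed_field james"
  assumes "\<And>i j. norm (james_nth x i - james_nth x j) \<le> 1"
    and "\<And>N. (\<Sum>i<N. norm (james_nth x (Suc i) - james_nth x i)) \<le> V"
  shows "norm x \<le> sqrt V"
  unfolding norm_james.rep_eq by (intro james_norm_le james_var_le_variation assms)

text \<open>Coordinate \<open>m\<close> of the sum collects the signs of those \<open>l\<close> with
  \<open>m \<le> k l\<close>. These form a final segment of the indices, so the signs cancel to 0 or
  to the last sign. Hence the oscillation is at most 1, and the variation is at most 1 for each of
  the \<open>L\<close> jumps.\<close>

lemma norm_james_alternating_steps:
  assumes k: "strict_mono k"
  shows "norm (\<Sum>l<L. (-1) ^ l *\<^sub>R (james_step (k l) :: 'k::real_normed_field james)) \<le> sqrt (real L)"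
    (is "norm (?x L) \<le> _")
proof (rule james_norm_le_variation)
  interpret nth: bounded_linear "\<lambda>x :: 'k james. james_nth x m" for m
    by (rule bounded_linear_james_nth)
  have nth: "james_nth (?x L) m = (\<Sum>l<L. if m \<le> k l then (-1) ^ l else 0)" for L m
    unfolding nth.sum
    by (rule sum.cong) (auto simp: scaleR_james.rep_eq james_step.rep_eq scaleR_conv_of_real)
  \<comment> \<open>\<open>- ((-1) ^ L)\<close> is the sign of the last summand, whose index is
    \<open>L - 1\<close>.\<close>
  have vals: "james_nth (?x L) m = 0 \<or> james_nth (?x L) m = - ((-1) ^ L)" for m
  proof (induction L)
    case (Suc L)
    show ?case
    proof (cases "m \<le> k L")
      case True
      then show ?thesis using Suc unfolding nth by auto
    next
      case False
      then have "\<not> m \<le> k l" if "l < Suc L" for l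
        using that strict_mono_leD[OF k, of l L] by linarith
      then have "james_nth (?x (Suc L)) m = 0"
        unfolding nth by (intro sum.neutral) auto
      then show ?thesis by blast
    qed
  qed (simp add: nth)
  show "norm (james_nth (?x L) i - james_nth (?x L) j) \<le> 1" for i j
    using vals[of i] vals[of j] by (auto simp: norm_power)
  fix N
  have "(\<Sum>i<N. norm (james_nth (?x L) (Suc i) - james_nth (?x L) i)) \<le> (\<Sum>i<N. \<Sum>l<L. if i = k l then 1 else 0)"
    unfolding nth sum_subtractf[symmetric]
    by (intro sum_mono sum_norm_le) (auto simp: norm_power)
  also have "\<dots> = (\<Sum>l<L. \<Sum>i<N. if i = k l then 1 else 0)"
    by (rule sum.swap)
  also have "\<dots> \<le> (\<Sum>l<L. 1)"
    by (intro sum_mono) simp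
  finally show "(\<Sum>i<N. norm (james_nth (?x L) (Suc i) - james_nth (?x L) i)) \<le> real L"
    by simp
qed

lemma norm_james_step: "norm (james_step k :: 'k::real_normed_field james) \<le> 1"
  using norm_james_alternating_steps[of "\<lambda>l. k + l" 1] by (auto simp: strict_mono_def)

text \<open>Pairing neighbours turns the sum into \<open>J\<close> differences. Cauchy-Schwarz costs
  \<open>sqrt (real J)\<close>, and the squares of these differences are every other increment along
  the chain \<open>m 0 < ... < m (2 * J - 1)\<close>.\<close>

lemma norm_alternating_james_nth:
  fixes x :: "'k::real_normed_field james"
  assumes m: "strict_mono m"
  shows "norm (\<Sum>l<2*J. (-1) ^ l *\<^sub>R james_nth x (m l)) \<le> sqrt 2 * sqrt (real J) * norm x"
proof (cases "J = 0")
  case False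
  let ?d = "\<lambda>k. norm (james_nth x (m k) - james_nth x (m (k - 1)))"
  have c: "(2 * J - 1, m) \<in> james_chains"
    using False m by (auto simp: james_chains_def strict_mono_on_def strict_mono_def)
  have "L2_set (\<lambda>j. ?d (2 * j + 1)) {..<J} \<le> james_var (2 * J - 1, m) (james_nth x)"
  proof -
    have "(\<Sum>j<J. (?d (2 * j + 1))\<^sup>2) = (\<Sum>k\<in>(\<lambda>j. 2 * j + 1) ` {..<J}. (?d k)\<^sup>2)"
      by (subst sum.reindex) (auto simp: inj_on_def)
    also have "\<dots> \<le> (\<Sum>k=1..2*J-1. (?d k)\<^sup>2)"
      by (intro sum_mono2) auto
    finally show ?thesis
      unfolding L2_set_def james_var_def by (simp add: add_increasing)
  qed
  also have "\<dots> \<le> sqrt 2 * norm x"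
    using james_var_le_norm[OF james_nth c] by (simp add: norm_james.rep_eq)
  finally have d: "L2_set (\<lambda>j. ?d (2 * j + 1)) {..<J} \<le> sqrt 2 * norm x" .
  have "(\<Sum>l<2*J. (-1) ^ l *\<^sub>R james_nth x (m l)) =
      (\<Sum>j<J. james_nth x (m (2 * j)) - james_nth x (m (2 * j + 1)))"
    by (induction J) auto
  also have "norm \<dots> \<le> (\<Sum>j<J. ?d (2 * j + 1))"
    by (intro sum_norm_le) (simp add: norm_minus_commute)
  also have "\<dots> = (\<Sum>j<J. \<bar>1\<bar> * \<bar>?d (2 * j + 1)\<bar>)" by simp
  also have "\<dots> \<le> L2_set (\<lambda>_. 1) {..<J} * L2_set (\<lambda>j. ?d (2 * j + 1)) {..<J}"
    by (rule L2_set_mult_ineq)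
  also have "L2_set (\<lambda>_. 1) {..<J} = sqrt (real J)"
    by (simp add: L2_set_def)
  also have "sqrt (real J) * L2_set (\<lambda>j. ?d (2 * j + 1)) {..<J} \<le> sqrt (real J) * (sqrt 2 * norm x)"
    by (intro mult_left_mono d) simp
  finally show ?thesis by (simp only: ac_simps)
qed simp

lemma bounded_linear_alternating_james_nth:
  "bounded_linear (\<lambda>x :: 'k::real_normed_field james. \<Sum>l<L. (-1) ^ l *\<^sub>R james_nth x (m l))"
  by (intro bounded_linear_sum bounded_linear_const_scaleR bounded_linear_james_nth)

section \<open>From unconditional to Besselian frames\<close>

text \<open>This makes a selected part of a block contiguous without disturbing the rest of a
  series.\<close>

lemma permute_initial_segment:
  fixes a b :: nat
  assumes "F \<subseteq> {a..<b}"
  obtains p where "bij_betw p {a..<b} {a..<b}" "p ` {a..<a + card F} = F"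
proof -
  have fin: "finite F" using assms finite_subset by blast
  have card: "card F \<le> b - a"
    using card_mono[OF _ assms] by simp
  obtain f where f: "bij_betw f {a..<a + card F} F"
    using finite_same_card_bij[of "{a..<a + card F}" F] fin by auto
  obtain g where g: "bij_betw g {a + card F..<b} ({a..<b} - F)"
    using finite_same_card_bij[of "{a + card F..<b}" "{a..<b} - F"] fin assms
    by (auto simp: card_Diff_subset)
  define p where "p = (\<lambda>n. if n \<in> {a..<a + card F} then f n else g n)"
  have eq: "{a..<b} = {a..<a + card F} \<union> {a + card F..<b}" "{a..<b} = F \<union> ({a..<b} - F)"
    using card assms card_0_eq[OF fin] by (auto simp: not_less)
  have "bij_betw p ({a..<a + card F} \<union> {a + card F..<b}) (F \<union> ({a..<b} - F))"
    unfolding p_def by (rule bij_betw_disjoint_Un[OF f g]) auto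
  then have "bij_betw p {a..<b} {a..<b}"
    using eq by simp
  moreover have "p ` {a..<a + card F} = F"
    using f by (auto simp: p_def bij_betw_def)
  ultimately show ?thesis using that by blast
qed

text \<open>Either the finite sums beyond some \<open>N\<close> stay below 1, and the head adds only
  a constant; or successive blocks contain sets with sums of norm at least 1. In the latter case a
  permutation makes each of these sets contiguous, and the rearranged series violates the Cauchy
  criterion.\<close>

lemma unconditionally_summable_bounded_sums:
  fixes f :: "nat \<Rightarrow> 'a::banach"
  assumes "unconditionally_summable f"
  shows "\<exists>M. \<forall>F. finite F \<longrightarrow> norm (sum f F) \<le> M"
proof (cases "\<exists>N. \<forall>F. finite F \<longrightarrow> F \<subseteq> {N..} \<longrightarrow> norm (sum f F) < 1")
  case True
  then obtain N where N: "\<And>F. finite F \<Longrightarrow> F \<subseteq> {N..} \<Longrightarrow> norm (sum f F) < 1" by blast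
  have "norm (sum f F) \<le> (\<Sum>n<N. norm (f n)) + 1" if "finite F" for F
  proof -
    have "sum f F = sum f (F \<inter> {..<N}) + sum f (F - {..<N})"
      by (rule sum.Int_Diff[OF that])
    also have "norm \<dots> \<le> (\<Sum>n\<in>F \<inter> {..<N}. norm (f n)) + 1"
    proof (rule norm_triangle_mono[OF norm_sum])
      show "norm (sum f (F - {..<N})) \<le> 1"
        using N[of "F - {..<N}"] that by fastforce
    qed
    also have "(\<Sum>n\<in>F \<inter> {..<N}. norm (f n)) \<le> (\<Sum>n<N. norm (f n))"
      by (rule sum_mono2) auto
    finally show ?thesis by simp
  qed
  then show ?thesis by blast
next
  case False
  have "\<exists>F b. F \<subseteq> {a..<b} \<and> a < b \<and> norm (sum f F) \<ge> 1" for a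
  proof -
    from False obtain F where F: "finite F" "F \<subseteq> {a..}" "norm (sum f F) \<ge> 1"
      by (meson not_less)
    obtain b where "F \<subseteq> {..<b}" using F(1) finite_nat_iff_bounded by blast
    with F(2) have "F \<subseteq> {a..<max b (Suc a)}" by (fastforce simp: less_max_iff_disj)
    moreover have "a < max b (Suc a)" by simp
    ultimately show ?thesis using F(3) by blast
  qed
  then obtain F b where Fb: "\<And>a. F a \<subseteq> {a..<b a}" "\<And>a. a < b a" "\<And>a. norm (sum f (F a)) \<ge> 1"
    by metis
  txt \<open>The permutation lists, within the block from \<open>a j\<close> to \<open>a (Suc j)\<close>, the elements of
    \<open>F (a j)\<close> first.\<close>
  define a where "a = (\<lambda>j. (b ^^ j) 0)"
  have a_Suc: "a (Suc j) = b (a j)" for j by (simp add: a_def)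
  have a: "strict_mono a" using Fb(2) by (simp add: strict_mono_Suc_iff a_Suc)
  define B where "B = (\<lambda>j. {a j..<a (Suc j)})"
  have "\<exists>p. bij_betw p (B j) (B j) \<and> p ` {a j..<a j + card (F (a j))} = F (a j)" for j
    using permute_initial_segment[OF Fb(1)[of "a j"]] by (metis B_def a_Suc)
  then obtain p where p: "\<And>j. bij_betw (p j) (B j) (B j)"
    "\<And>j. p j ` {a j..<a j + card (F (a j))} = F (a j)"
    by metis
  have disj: "i = j" if "n \<in> B i" "n \<in> B j" for i j n
  proof (rule ccontr)
    assume "i \<noteq> j"
    then consider "Suc i \<le> j" | "Suc j \<le> i" by linarith
    then show False
      using that strict_mono_leD[OF a, of "Suc i" j] strict_mono_leD[OF a, of "Suc j" i]
      by cases (auto simp: B_def)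
  qed
  have cover: "\<exists>j. n \<in> B j" for n
  proof -
    have ex: "\<exists>j. n < a (Suc j)"
      using strict_mono_imp_increasing[OF a, of "Suc n"] by (intro exI[of _ n]) simp
    define j where "j = (LEAST j. n < a (Suc j))"
    have "n < a (Suc j)" unfolding j_def using ex by (rule LeastI_ex)
    moreover have "a j \<le> n"
    proof (cases j)
      case 0
      then show ?thesis by (simp add: a_def)
    next
      case (Suc i)
      then show ?thesis using not_less_Least[of i "\<lambda>j. n < a (Suc j)"] j_def by simp
    qed
    ultimately show ?thesis by (auto simp: B_def)
  qed
  define \<pi> where "\<pi> = (\<lambda>n. p (THE j. n \<in> B j) n)"
  have \<pi>: "\<pi> n = p j n" if "n \<in> B j" for n j
  proof -
    have "(THE j. n \<in> B j) = j" using that disj by blast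
    then show ?thesis by (simp add: \<pi>_def)
  qed
  have "bij_betw \<pi> (\<Union>j\<in>UNIV. B j) (\<Union>j\<in>UNIV. B j)"
  proof (rule bij_betw_UNION_disjoint)
    show "disjoint_family_on B UNIV"
      using disj by (auto simp: disjoint_family_on_def)
    show "bij_betw \<pi> (B j) (B j)" for j
      using p(1)[of j] bij_betw_cong[of "B j" \<pi> "p j"] \<pi> by blast
  qed
  moreover have "(\<Union>j\<in>UNIV. B j) = UNIV" using cover by blast
  ultimately have "bij \<pi>" by simp
  with assms have "summable (\<lambda>n. f (\<pi> n))"
    by (simp add: unconditionally_summable_def)
  then obtain N where N: "\<And>m n. m \<ge> N \<Longrightarrow> norm (\<Sum>i\<in>{m..<n}. f (\<pi> i)) < 1"
    unfolding summable_Cauchy by (meson zero_less_one)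
  \<comment> \<open>\<open>N\<close> serves also as a block number: block \<open>N\<close> starts at
    \<open>a N\<close>, which is at least \<open>N\<close>.\<close>
  let ?I = "{a N..<a N + card (F (a N))}"
  have "card (F (a N)) \<le> a (Suc N) - a N"
    using card_mono[OF _ Fb(1)[of "a N"]] by (simp add: a_Suc)
  then have sub: "?I \<subseteq> B N"
    using strict_monoD[OF a, of N "Suc N"] by (auto simp: B_def)
  have "inj_on (p N) ?I"
    using p(1)[of N] sub by (meson bij_betw_def inj_on_subset)
  then have "sum f (F (a N)) = (\<Sum>i\<in>?I. f (p N i))"
    by (subst p(2)[of N, symmetric]) (simp add: sum.reindex)
  also have "\<dots> = (\<Sum>i\<in>?I. f (\<pi> i))"
    using sub by (intro sum.cong) (auto simp: \<pi>)
  finally have "norm (sum f (F (a N))) < 1"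
    using N[of "a N"] strict_mono_imp_increasing[OF a, of N] by simp
  with Fb(3)[of "a N"] show ?thesis by linarith
qed

lemma unconditional_imp_besselian:
  fixes s :: "'k::{real_normed_field, euclidean_space} \<Rightarrow> 'a::banach \<Rightarrow> 'a"
  assumes vs: "vector_space s"
    and norm_s: "\<And>c x. norm (s c x) = norm c * norm x"
    and s_of_real: "\<And>r x. s (of_real r) x = r *\<^sub>R x"
    and uncond: "unconditional_schauder_frame s a b"
  shows "besselian_schauder_frame s a b"
proof -
  interpret vector_space s by (rule vs)
  have frame: "schauder_frame s a b" and us: "\<And>x. unconditionally_summable (\<lambda>n. s (b n x) (a n))"
    using uncond by (auto simp: unconditional_schauder_frame_def)
  have b: "bounded_linear (b n)" for n
    using frame by (auto simp: schauder_frame_def dual_space_def)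
  define T where "T = (\<lambda>F x. \<Sum>n\<in>F. s (b n x) (a n))"
  have lin: "bounded_linear (T F)" for F
    unfolding T_def
  proof (rule bounded_linear_sum)
    fix n
    interpret bounded_linear "b n" by (rule b)
    obtain K where K: "\<And>x. norm (b n x) \<le> norm x * K" using bounded by blast
    show "bounded_linear (\<lambda>x. s (b n x) (a n))"
    proof (rule bounded_linear_intro[where K = "K * norm (a n)"])
      show "s (b n (x + y)) (a n) = s (b n x) (a n) + s (b n y) (a n)" for x y
        by (simp add: add scale_left_distrib)
      show "s (b n (r *\<^sub>R x)) (a n) = r *\<^sub>R s (b n x) (a n)" for r x
        by (metis scaleR scaleR_conv_of_real scale_scale s_of_real)
      show "norm (s (b n x) (a n)) \<le> norm x * (K * norm (a n))" for x
        using mult_right_mono[OF K[of x], of "norm (a n)"] by (simp add: norm_s mult.assoc)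
    qed
  qed
  have "\<exists>M. \<forall>F\<in>Collect finite. norm (T F x) \<le> M" for x
    using unconditionally_summable_bounded_sums[OF us[of x]] by (simp add: T_def)
  from uniform_boundedness[of "Collect finite" T, OF lin this]
  obtain C where C: "C > 0" "\<And>F x. finite F \<Longrightarrow> norm (T F x) \<le> C * norm x"
    by auto
  \<comment> \<open>A bound on all finite subset sums of scalars bounds the sum of their norms up to
    the factor \<open>2 * DIM('k)\<close>; this is where finite dimension of the scalars
    enters.\<close>
  define B where "B = 2 * real DIM('k) * C"
  have "summable (\<lambda>n. norm (b n x) * norm (y (a n))) \<and>
      (\<Sum>n. norm (b n x) * norm (y (a n))) \<le> B * norm x * onorm y"
    if y: "y \<in> dual_space s" for x y
  proof -
    interpret y: bounded_linear y using y by (simp add: dual_space_def)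
    have ys: "y (s c z) = c * y z" for c z
      using y by (simp add: dual_space_def)
    have part: "(\<Sum>n<N. norm (b n x) * norm (y (a n))) \<le> B * norm x * onorm y" for N
    proof -
      have "(\<Sum>n<N. norm (b n x * y (a n))) \<le> 2 * real DIM('k) * (onorm y * (C * norm x))"
      proof (rule sum_norm_allsubsets_bound)
        fix Q assume "Q \<subseteq> {..<N}"
        then have Q: "finite Q" by (rule finite_subset) simp
        have "norm (\<Sum>n\<in>Q. b n x * y (a n)) = norm (y (T Q x))"
          by (simp add: T_def y.sum ys)
        also have "\<dots> \<le> onorm y * norm (T Q x)"
          by (rule onorm[OF y.bounded_linear_axioms])
        also have "\<dots> \<le> onorm y * (C * norm x)"
          using C(2)[OF Q] onorm_pos_le[OF y.bounded_linear_axioms] by (intro mult_left_mono)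
        finally show "norm (\<Sum>n\<in>Q. b n x * y (a n)) \<le> onorm y * (C * norm x)" .
      qed simp
      then show ?thesis by (simp add: norm_mult B_def ac_simps)
    qed
    have "summable (\<lambda>n. norm (b n x) * norm (y (a n)))"
      by (rule bounded_imp_summable[of _ "B * norm x * onorm y"])
        (use part[of "Suc _"] in \<open>simp_all add: lessThan_Suc_atMost\<close>)
    then show ?thesis
      using suminf_le_const part by blast
  qed
  moreover have "B > 0" using C(1) by (simp add: B_def)
  ultimately show ?thesis
    using frame unfolding besselian_schauder_frame_def by blast
qed

section \<open>The contradiction from a Besselian frame\<close>

text \<open>A diagonal argument over \<open>n\<close>. Dividing by \<open>K n\<close> brings all the
  functionals under the common bound 1, and the 1 added in \<open>K n\<close> makes the division
  legitimate.\<close>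

lemma pointwise_convergent_subsequence:
  fixes f :: "nat \<Rightarrow> 'a::real_normed_vector \<Rightarrow> 'b::{real_normed_vector, heine_borel}"
    and s :: "nat \<Rightarrow> 'a"
  assumes f: "\<And>n. bounded_linear (f n)" and s: "\<And>k. norm (s k) \<le> 1"
  shows "\<exists>\<kappa> c. strict_mono \<kappa> \<and> (\<forall>n. (\<lambda>i. f n (s (\<kappa> i))) \<longlonglongrightarrow> c n)"
proof -
  define K where "K = (\<lambda>n. onorm (f n) + 1)"
  have K: "K n > 0" for n
    using onorm_pos_le[OF f, of n] by (simp add: K_def)
  have "norm (f n (s k) /\<^sub>R K n) \<le> 1" for n k
  proof -
    have "norm (f n (s k)) \<le> onorm (f n) * norm (s k)"
      by (rule onorm[OF f])
    also have "\<dots> \<le> onorm (f n) * 1"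
      using s onorm_pos_le[OF f] by (intro mult_left_mono)
    finally show ?thesis using K[of n] by (simp add: K_def field_simps)
  qed
  then obtain \<kappa> where \<kappa>: "strict_mono \<kappa>" "\<And>n. \<exists>l. (\<lambda>i. f n (s (\<kappa> i)) /\<^sub>R K n) \<longlonglongrightarrow> l"
    using function_convergent_subsequence[of "UNIV :: nat set" "\<lambda>k n. f n (s k) /\<^sub>R K n" 1]
    by (metis UNIV_I countableI_type)
  then obtain l where l: "\<And>n. (\<lambda>i. f n (s (\<kappa> i)) /\<^sub>R K n) \<longlonglongrightarrow> l n" by metis
  have "(\<lambda>i. f n (s (\<kappa> i))) \<longlonglongrightarrow> K n *\<^sub>R l n" for n
    using tendsto_scaleR[OF tendsto_const[of "K n"] l[of n]] K[of n] by simp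
  then show ?thesis
    by (intro exI[of _ \<kappa>] exI[of _ "\<lambda>n. K n *\<^sub>R l n"] conjI allI \<kappa>(1))
qed

lemma no_besselian_schauder_frame_james:
  fixes a :: "nat \<Rightarrow> 'k::{real_normed_field, euclidean_space} james"
  shows "\<not> besselian_schauder_frame james_scale a b"
proof
  assume bes: "besselian_schauder_frame james_scale a b"
  then have frame: "schauder_frame james_scale a b"
    by (simp add: besselian_schauder_frame_def)
  obtain B where "B > 0" and B: "\<forall>x. \<forall>y\<in>dual_space james_scale.
      summable (\<lambda>n. norm (b n x) * norm (y (a n))) \<and>
      (\<Sum>n. norm (b n x) * norm (y (a n))) \<le> B * norm x * onorm y"
    using bes unfolding besselian_schauder_frame_def by (elim conjE exE)
  have summ: "summable (\<lambda>n. norm (b n x) * norm (y (a n)))"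
    if "y \<in> dual_space james_scale" for x y
    using B that by simp
  have part: "(\<Sum>n<N. norm (b n x) * norm (y (a n))) \<le> B * norm x * onorm y"
    if "y \<in> dual_space james_scale" for x y N
  proof -
    have "(\<Sum>n<N. norm (b n x) * norm (y (a n))) \<le> (\<Sum>n. norm (b n x) * norm (y (a n)))"
      by (intro sum_le_suminf summ that) auto
    also have "\<dots> \<le> B * norm x * onorm y"
      using B that by simp
    finally show ?thesis .
  qed
  have b: "bounded_linear (b n)" for n
    using frame by (auto simp: schauder_frame_def dual_space_def)
  have coord: "(\<lambda>x. james_nth x m) \<in> dual_space james_scale" for m
    using bounded_linear_james_nth by (auto simp: dual_space_def james_scale.rep_eq)
  define D where "D = (\<lambda>m. onorm (\<lambda>x :: 'k james. james_nth x m))"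
  obtain \<kappa> c where \<kappa>: "strict_mono \<kappa>" and c: "\<And>n. (\<lambda>i. b n (james_step (\<kappa> i))) \<longlonglongrightarrow> c n"
    using pointwise_convergent_subsequence[where f = b and s = james_step, OF b norm_james_step]
    by auto
  \<comment> \<open>The Besselian estimate for the steps, which have norm at most 1, passes to the
    limit on finite partial sums. Its uniformity in \<open>y\<close> is what the second hump
    argument uses.\<close>
  have c_bound: "(\<Sum>n<N. norm (c n) * norm (y (a n))) \<le> B * onorm y"
    if y: "y \<in> dual_space james_scale" for y N
  proof (rule LIMSEQ_le_const2)
    show "(\<lambda>i. \<Sum>n<N. norm (b n (james_step (\<kappa> i))) * norm (y (a n)))
        \<longlonglongrightarrow> (\<Sum>n<N. norm (c n) * norm (y (a n)))"
      by (intro tendsto_intros c)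
    have "(\<Sum>n<N. norm (b n (james_step (\<kappa> i))) * norm (y (a n))) \<le> B * onorm y" for i
    proof (rule order_trans[OF part[OF y]])
      have "B * norm (james_step (\<kappa> i) :: 'k james) * onorm y \<le> B * 1 * onorm y"
        using \<open>B > 0\<close> norm_james_step y onorm_pos_le[of y]
        by (intro mult_right_mono mult_left_mono) (auto simp: dual_space_def)
      then show "B * norm (james_step (\<kappa> i) :: 'k james) * onorm y \<le> B * onorm y" by simp
    qed
    then show "\<exists>M. \<forall>i\<ge>M. (\<Sum>n<N. norm (b n (james_step (\<kappa> i))) * norm (y (a n))) \<le> B * onorm y"
      by blast
  qed
  have c_summable: "summable (\<lambda>n. norm (c n * james_nth (a n) m))" for m
    by (rule bounded_imp_summable[of _ "B * D m"])
      (use c_bound[OF coord, of _ "Suc _"] in \<open>simp_all add: lessThan_Suc_atMost norm_mult D_def\<close>)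
  have c_sum: "(\<Sum>n. c n * james_nth (a n) m) = 1" for m
  proof -
    \<comment> \<open>The shift by \<open>m\<close> ensures \<open>m \<le> \<kappa> (m + i)\<close>,
      so that coordinate \<open>m\<close> of every \<open>x i\<close> is exactly 1.\<close>
    define x where "x = (\<lambda>i. james_step (\<kappa> (m + i)) :: 'k james)"
    define g where "g = (\<lambda>i n. (b n (x i) - c n) * james_nth (a n) m)"
    have g_eq: "g i = (\<lambda>n. b n (x i) * james_nth (a n) m - c n * james_nth (a n) m)" for i
      by (simp add: g_def left_diff_distrib)
    have b_summable: "summable (\<lambda>n. norm (b n (x i) * james_nth (a n) m))" for i
      using summ[OF coord] by (simp add: norm_mult)
    have "1 - (\<Sum>n. c n * james_nth (a n) m) = 0"
    proof (rule gliding_hump)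
      show "summable (\<lambda>n. norm (g i n))" for i
        by (rule summable_comparison_test'[OF summable_add[OF b_summable[of i] c_summable[of m]], of 0])
           (simp add: g_eq norm_triangle_ineq4)
      show "(\<lambda>i. g i n) \<longlonglongrightarrow> 0" for n
      proof -
        have "(\<lambda>i. b n (x i)) \<longlonglongrightarrow> c n"
          unfolding x_def using LIMSEQ_ignore_initial_segment[OF c[of n], of m] by (simp add: add.commute)
        then show ?thesis
          unfolding g_def by (intro tendsto_mult_left_zero) (simp add: LIM_zero)
      qed
      show "(\<Sum>n. g i n) = 1 - (\<Sum>n. c n * james_nth (a n) m)" for i
      proof -
        have "(\<lambda>n. james_nth (james_scale (b n (x i)) (a n)) m) sums james_nth (x i) m"
          using frame by (intro bounded_linear.sums[OF bounded_linear_james_nth])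
            (simp add: schauder_frame_def)
        moreover have "m \<le> \<kappa> (m + i)"
          using strict_mono_imp_increasing[OF \<kappa>, of "m + i"] by linarith
        ultimately have "(\<lambda>n. b n (x i) * james_nth (a n) m) sums 1"
          by (simp add: x_def james_step.rep_eq james_scale.rep_eq)
        from sums_diff[OF this summable_sums[OF summable_norm_cancel[OF c_summable[of m]]]]
        show ?thesis
          unfolding g_eq by (rule sums_unique[symmetric])
      qed
      fix k :: "nat \<Rightarrow> nat" and J N
      assume k: "strict_mono k"
      define u where "u = (\<Sum>l<2*J. (-1) ^ l *\<^sub>R x (k l))"
      have "(\<Sum>l<2*J. (-1) ^ l *\<^sub>R g (k l) n) = b n u * james_nth (a n) m" for n
      proof -
        interpret bounded_linear "b n" by (rule b)
        have "(\<Sum>l<2*J. (-1) ^ l *\<^sub>R g (k l) n) =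
            (\<Sum>l<2*J. (-1) ^ l *\<^sub>R b n (x (k l))) * james_nth (a n) m -
            (\<Sum>l<2*J. (-1) ^ l) *\<^sub>R (c n * james_nth (a n) m)"
          by (simp add: g_eq scaleR_diff_right sum_subtractf scaleR_sum_left sum_distrib_right)
        \<comment> \<open>An even number of alternating signs removes \<open>c n\<close>, leaving
          \<open>b n\<close> at the single vector \<open>u\<close>, to which the Besselian bound
          applies.\<close>
        also have "(\<Sum>l<2*J. (-1) ^ l) = (0::real)"
          by (induction J) auto
        finally show ?thesis by (simp add: u_def sum scaleR)
      qed
      then have "(\<Sum>n<N. norm (\<Sum>l<2*J. (-1) ^ l *\<^sub>R g (k l) n)) =
          (\<Sum>n<N. norm (b n u) * norm (james_nth (a n) m))"
        by (simp add: norm_mult)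
      also have "\<dots> \<le> B * norm u * D m"
        unfolding D_def by (rule part[OF coord])
      also have "\<dots> \<le> B * (sqrt 2 * sqrt (real J)) * D m"
      proof (intro mult_right_mono mult_left_mono)
        have "strict_mono (\<lambda>l. \<kappa> (m + k l))"
          using k \<kappa> by (auto simp: strict_mono_def)
        from norm_james_alternating_steps[OF this, of "2 * J", where 'k = 'k]
        show "norm u \<le> sqrt 2 * sqrt (real J)"
          by (simp add: u_def x_def real_sqrt_mult)
      qed (use \<open>B > 0\<close> onorm_pos_le[OF bounded_linear_james_nth] in \<open>auto simp: D_def\<close>)
      finally show "(\<Sum>n<N. norm (\<Sum>l<2*J. (-1) ^ l *\<^sub>R g (k l) n)) \<le> (B * sqrt 2 * D m) * sqrt (real J)"
        by (simp add: ac_simps)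
    qed
    then show ?thesis by simp
  qed
  \<comment> \<open>Now the rows are indexed by the coordinate \<open>m\<close>. They decay because
    each \<open>a n\<close> is a null sequence, and the alternating sum is absorbed into the
    functional \<open>y\<close> instead of a vector.\<close>
  have "(1::'k) = 0"
  proof (rule gliding_hump)
    show "summable (\<lambda>n. norm (c n * james_nth (a n) m))" for m
      by (rule c_summable)
    show "(\<lambda>m. c n * james_nth (a n) m) \<longlonglongrightarrow> 0" for n
      by (intro tendsto_mult_right_zero james_nth_tendsto)
    show "(\<Sum>n. c n * james_nth (a n) m) = 1" for m
      by (rule c_sum)
    fix k :: "nat \<Rightarrow> nat" and J N
    assume k: "strict_mono k"
    define y where "y = (\<lambda>x :: 'k james. \<Sum>l<2*J. (-1) ^ l *\<^sub>R james_nth x (k l))"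
    have y: "y \<in> dual_space james_scale"
      using bounded_linear_alternating_james_nth
      by (auto simp: y_def dual_space_def james_scale.rep_eq sum_distrib_left)
    have "onorm y \<le> sqrt 2 * sqrt (real J)"
      unfolding y_def by (intro onorm_bound norm_alternating_james_nth k) simp
    then have "B * onorm y \<le> B * (sqrt 2 * sqrt (real J))"
      using \<open>B > 0\<close> by simp
    moreover have "(\<Sum>n<N. norm (\<Sum>l<2*J. (-1) ^ l *\<^sub>R (c n * james_nth (a n) (k l)))) =
        (\<Sum>n<N. norm (c n) * norm (y (a n)))"
      unfolding norm_mult[symmetric] y_def sum_distrib_left by simp
    ultimately show "(\<Sum>n<N. norm (\<Sum>l<2*J. (-1) ^ l *\<^sub>R (c n * james_nth (a n) (k l)))) \<le>
        (B * sqrt 2) * sqrt (real J)"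
      using c_bound[OF y, of N] by simp
  qed
  then show False by simp
qed

lemma no_unconditional_schauder_frame_james:
  fixes a :: "nat \<Rightarrow> 'k::{real_normed_field, euclidean_space} james"
  shows "\<not> unconditional_schauder_frame james_scale a b"
  using unconditional_imp_besselian[OF vector_space_james_scale norm_james_scale james_scale_of_real]
    no_besselian_schauder_frame_james[of a b]
  by blast

theorem corollary12:
  shows "(\<nexists>(a :: nat \<Rightarrow> real james) b. besselian_schauder_frame james_scale a b) \<and>
         (\<nexists>(a :: nat \<Rightarrow> real james) b. unconditional_schauder_frame james_scale a b) \<and>
         (\<nexists>(a :: nat \<Rightarrow> complex james) b. besselian_schauder_frame james_scale a b) \<and>
         (\<nexists>(a :: nat \<Rightarrow> complex james) b. unconditional_schauder_frame james_scale a b)"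
  by (simp add: no_besselian_schauder_frame_james no_unconditional_schauder_frame_james)

end
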